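(* Let $\mathbb{F}$ be a field with $|\mathbb{F}|\geq 4$. Let $A=(a_{ij})\in\mathbf{H}_{\mathbb{F}}^{5\times 2}$ be a matrix such that $\mathrm{rank}(A)=2$ and $$\deg(a_{p1}a_{q2}-a_{q1}a_{p2})=\min\{\deg a_{p1}+\deg a_{q2},\ \deg a_{q1}+\deg a_{p2}\}$$ for all distinct $p,q\in\{1,\ldots,5\}$. Let $B\in\mathbb{R}^{5\times n}$, and for every $j\in\{1,\ldots,n\}$ denote $$\Theta_{1j}=\Theta(\deg A^{(1)},B^{(j)}),\qquad \Theta_{2j}=\Theta(\deg A^{(2)},B^{(j)}).$$ If $|\Theta_{1j}|\geq 2$, $|\Theta_{2j}|\geq 2$ and $|\Theta_{1j}\cup\Theta_{2j}|\geq 3$ for every $j\in\{1,\ldots,n\}$, then $\mathrm{K}_{\mathbb{F}}(B)\leq 3$.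
   Context: For a field $\mathbb{F}$, let $\mathbf{H}_{\mathbb{F}}$ denote the field of formal sums $a(t)=\sum_{e\in\mathbb{R}}a_e t^e$ with coefficients $a_e\in\mathbb{F}$ whose support $E(a)=\{e\in\mathbb{R}: a_e\neq 0\}$ is a well-ordered subset of $\mathbb{R}$ (usual addition and multiplication of generalized power series, i.e. Hahn series with value group $\mathbb{R}$). Write $\mathbf{H}_{\mathbb{F}}^*$ for its set of nonzero elements. For $a\in\mathbf{H}_{\mathbb{F}}^*$, the degree is $\deg a=\min E(a)$, and $\deg 0=+\infty$. For matrices and vectors over $\mathbf{H}_{\mathbb{F}}$, $\deg$ is applied entrywise. $A^{(j)}$ denotes the $j$th column of a matrix $A$. For vectors $a,b\in(\mathbb{R}\cup\{+\infty\})^m$, $\Theta(a,b)$ denotes the set of all indices $i\in\{1,\ldots,m\}$ at which the minimum $\min_{i=1}^m\{a_i+b_i\}$ is attained. The Kapranov rank of $B\in\mathbb{R}^{m\times n}$ with respect to the ground field $\mathbb{F}$ is $$\mathrm{K}_{\mathbb{F}}(B)=\min\{\mathrm{rank}(A) : A\in(\mathbf{H}_{\mathbb{F}}^* )^{m\times n},\ \deg A=B\},$$ where $\mathrm{rank}$ is the usual rank of matrices over the field $\mathbf{H}_{\mathbb{F}}$. *)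

theory Defs
  imports "HOL-Analysis.Analysis"
begin

section \<open>Well-ordered sets of reals\<close>

abbreviation well_ordered :: "real set \<Rightarrow> bool" where
  "well_ordered S \<equiv> wfp_on S (<)"

lemma well_ordered_iff:
  "well_ordered S \<longleftrightarrow> (\<forall>T\<subseteq>S. T \<noteq> {} \<longrightarrow> (\<exists>m\<in>T. \<forall>x\<in>T. m \<le> x))"
proof -
  have "(\<forall>y. y < z \<longrightarrow> y \<notin> T) \<longleftrightarrow> (\<forall>x\<in>T. z \<le> x)" for z and T :: "real set"
  proof
    assume T: "\<forall>y. y < z \<longrightarrow> y \<notin> T"
    show "\<forall>x\<in>T. z \<le> x"
    proof
      fix x assume "x \<in> T"
      with T have "\<not> x < z" by blast
      then show "z \<le> x" by linarith
    qed
  qed force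
  then show ?thesis by (simp only: wfp_on_iff_ex_minimal)
qed

lemma well_ordered_min:
  assumes "well_ordered S" "T \<subseteq> S" "T \<noteq> {}"
  obtains m where "m \<in> T" "\<And>x. x \<in> T \<Longrightarrow> m \<le> x"
proof -
  have "\<exists>m\<in>T. \<forall>x\<in>T. m \<le> x"
    using assms(1)[unfolded well_ordered_iff, rule_format, OF assms(2,3)] .
  then show thesis using that by blast
qed

lemma well_ordered_subset: "well_ordered T \<Longrightarrow> S \<subseteq> T \<Longrightarrow> well_ordered S"
  by (rule wfp_on_subset)

lemma well_ordered_empty [simp]: "well_ordered {}"
  by (simp add: well_ordered_iff)

lemma well_ordered_singleton [simp]: "well_ordered {x}"
  unfolding well_ordered_iff by auto

lemma well_ordered_Un:
  assumes S: "well_ordered S" and T: "well_ordered T"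
  shows "well_ordered (S \<union> T)"
  unfolding well_ordered_iff
proof (intro allI impI)
  fix U assume U: "U \<subseteq> S \<union> T" "U \<noteq> {}"
  show "\<exists>m\<in>U. \<forall>x\<in>U. m \<le> x"
  proof (cases "U \<inter> S = {} \<or> U \<inter> T = {}")
    case True
    then have "U \<subseteq> S \<or> U \<subseteq> T" using U by blast
    then show ?thesis using S T U unfolding well_ordered_iff by blast
  next
    case False
    obtain m where m: "m \<in> U \<inter> S" "\<And>x. x \<in> U \<inter> S \<Longrightarrow> m \<le> x"
      using well_ordered_min[OF S, of "U \<inter> S"] False by blast
    obtain m' where m': "m' \<in> U \<inter> T" "\<And>x. x \<in> U \<inter> T \<Longrightarrow> m' \<le> x"
      using well_ordered_min[OF T, of "U \<inter> T"] False by blast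
    show ?thesis
    proof (rule bexI[of _ "min m m'"])
      show "\<forall>x\<in>U. min m m' \<le> x"
        using m m' U by (auto simp: min_le_iff_disj)
      show "min m m' \<in> U" using m m' by (auto simp: min_def)
    qed
  qed
qed

lemma well_ordered_incseq:
  assumes "well_ordered S" and f: "\<And>n::nat. f n \<in> S"
  obtains g where "strict_mono (g :: nat \<Rightarrow> nat)" "incseq (\<lambda>n. f (g n))"
proof -
  obtain g where g: "strict_mono (g :: nat \<Rightarrow> nat)" "monoseq (\<lambda>n. f (g n))"
    using seq_monosub[of f] by blast
  show thesis
  proof (cases "incseq (\<lambda>n. f (g n))")
    case True
    then show ?thesis using g that by blast
  next
    case False
    then have dec: "decseq (\<lambda>n. f (g n))"
      using g(2) by (simp add: monoseq_iff)
    obtain m where m: "m \<in> range (\<lambda>n. f (g n))" "\<And>x. x \<in> range (\<lambda>n. f (g n)) \<Longrightarrow> m \<le> x"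
      using well_ordered_min[OF assms(1), of "range (\<lambda>n. f (g n))"] f by blast
    then obtain N where N: "m = f (g N)" by blast
    have c: "f (g (n + N)) = m" for n
    proof (rule antisym)
      show "f (g (n + N)) \<le> m" unfolding N using dec by (simp add: decseq_def)
      show "m \<le> f (g (n + N))" using m by blast
    qed
    have "strict_mono (\<lambda>n. g (n + N))"
      using g(1) by (simp add: strict_mono_def)
    then show ?thesis using that[of "\<lambda>n. g (n + N)"] c by (simp add: incseq_def)
  qed
qed

lemma well_orderedI_seq:
  assumes "\<And>f. (\<And>n::nat. f n \<in> S) \<Longrightarrow> (\<And>n. f (Suc n) < f n) \<Longrightarrow> False"
  shows "well_ordered S"
proof (rule ccontr)
  assume "\<not> well_ordered S"
  then obtain T where T: "T \<subseteq> S" "T \<noteq> {}" "\<And>m. m \<in> T \<Longrightarrow> \<exists>x\<in>T. x < m"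
    unfolding well_ordered_iff by (metis not_le)
  have "\<exists>f::nat \<Rightarrow> real. \<forall>n. f n \<in> T \<and> f (Suc n) < f n"
    by (rule dependent_nat_choice) (use T in blast)+
  then show False using assms T(1) by blast
qed

lemma well_ordered_sumset:
  assumes S: "well_ordered S" and T: "well_ordered T"
  shows "well_ordered {x + y |x y. x \<in> S \<and> y \<in> T}"
proof (rule well_orderedI_seq)
  fix f :: "nat \<Rightarrow> real"
  assume "\<And>n. f n \<in> {x + y |x y. x \<in> S \<and> y \<in> T}" and dec: "\<And>n. f (Suc n) < f n"
  then have "\<forall>n. \<exists>x y. f n = x + y \<and> x \<in> S \<and> y \<in> T" by blast
  then obtain s t where st: "\<And>n. f n = s n + t n" "\<And>n. s n \<in> S" "\<And>n. t n \<in> T"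
    by metis
  obtain g where g: "strict_mono (g :: nat \<Rightarrow> nat)" "incseq (\<lambda>n. s (g n))"
    using well_ordered_incseq[OF S, of s] st by blast
  obtain h where h: "strict_mono (h :: nat \<Rightarrow> nat)" "incseq (\<lambda>n. t (g (h n)))"
    using well_ordered_incseq[OF T, of "\<lambda>n. t (g n)"] st by blast
  have lt: "h 0 < h 1" using h(1) by (simp add: strict_mono_def)
  then have "g (h 0) < g (h 1)" using g(1) by (simp add: strict_mono_def)
  then have "f (g (h 1)) < f (g (h 0))"
    using dec by (metis lift_Suc_mono_less[of "\<lambda>n. - f n"] neg_less_iff_less)
  moreover have "s (g (h 0)) \<le> s (g (h 1))" using g(2) lt by (simp add: incseq_def)
  moreover have "t (g (h 0)) \<le> t (g (h 1))" using h(2) by (simp add: incseq_def)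
  ultimately show False using st(1) by (smt (verit))
qed

lemma sumsetI: "s \<in> S \<Longrightarrow> e - s \<in> T \<Longrightarrow> e \<in> {x + y |x y. x \<in> S \<and> y \<in> T}" for e :: real
  by (rule CollectI, rule exI[of _ s], rule exI[of _ "e - s"]) simp

lemma finite_well_ordered_decomp:
  assumes S: "well_ordered S" and T: "well_ordered T"
  shows "finite {x. x \<in> S \<and> e - x \<in> T}"
proof (rule ccontr)
  define X where "X = {x. x \<in> S \<and> e - x \<in> T}"
  assume "infinite {x. x \<in> S \<and> e - x \<in> T}"
  then have inf: "infinite X" by (simp add: X_def)
  define I where "I = {x\<in>X. finite {y\<in>X. y \<le> x}}"
  have mn: "\<exists>m\<in>U. \<forall>x\<in>U. m \<le> x" if "U \<subseteq> X" "U \<noteq> {}" for U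
    using that S unfolding X_def well_ordered_iff by blast
  have mx: "\<exists>m\<in>U. \<forall>x\<in>U. x \<le> m" if U: "U \<subseteq> X" "U \<noteq> {}" for U
  proof -
    have "(\<lambda>x. e - x) ` U \<subseteq> T" using U by (auto simp: X_def)
    then obtain m where m: "m \<in> (\<lambda>x. e - x) ` U" "\<And>x. x \<in> (\<lambda>x. e - x) ` U \<Longrightarrow> m \<le> x"
      using well_ordered_min[OF T] U(2) by blast
    then obtain u where u: "u \<in> U" "m = e - u" by blast
    have "x \<le> u" if "x \<in> U" for x using m(2)[of "e - x"] that u by auto
    then show ?thesis using u by blast
  qed
  have "X \<noteq> {}" using inf by auto
  then obtain x0 where x0: "x0 \<in> X" "\<forall>x\<in>X. x0 \<le> x" using mn[of X] by auto
  then have "{y\<in>X. y \<le> x0} = {x0}" by force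
  then have "x0 \<in> I" using x0 by (simp add: I_def)
  then obtain m where m: "m \<in> I" "\<forall>x\<in>I. x \<le> m" using mx[of I] by (auto simp: I_def)
  have fin: "finite {y\<in>X. y \<le> m}" using m by (simp add: I_def)
  have "infinite (X - {y\<in>X. y \<le> m})" using inf fin by simp
  then have "X - {y\<in>X. y \<le> m} \<noteq> {}" by (metis finite.emptyI)
  then obtain m' where m': "m' \<in> X - {y\<in>X. y \<le> m}" "\<forall>x\<in>X - {y\<in>X. y \<le> m}. m' \<le> x"
    using mn[of "X - {y\<in>X. y \<le> m}"] by auto
  have "{y\<in>X. y \<le> m'} \<subseteq> insert m' {y\<in>X. y \<le> m}" 
  proof
    fix y assume y: "y \<in> {y\<in>X. y \<le> m'}"
    show "y \<in> insert m' {y\<in>X. y \<le> m}"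
    proof (cases "y \<le> m")
      case False
      then have "m' \<le> y" using m'(2) y by blast
      then show ?thesis using y by auto
    qed (use y in auto)
  qed
  then have "finite {y\<in>X. y \<le> m'}" using fin finite_subset by blast
  then have "m' \<in> I" using m' by (simp add: I_def)
  then show False using m m' by auto
qed

section \<open>Hahn series with value group the reals\<close>

typedef (overloaded) 'a hahn =
  "{f :: real \<Rightarrow> 'a::zero. well_ordered {e. f e \<noteq> 0}}"
  morphisms hahn_coeff Abs_hahn
  by (rule exI[of _ "\<lambda>_. 0"]) simp

setup_lifting type_definition_hahn

lemma hahn_eqI: "(\<And>e. hahn_coeff a e = hahn_coeff b e) \<Longrightarrow> a = b"
  by (rule hahn_coeff_inject[THEN iffD1], rule ext)

definition supp :: "'a::zero hahn \<Rightarrow> real set" where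
  "supp a = {e. hahn_coeff a e \<noteq> 0}"

lemma well_ordered_supp: "well_ordered (supp a)"
  using hahn_coeff[of a] by (simp add: supp_def)

instantiation hahn :: (zero) zero
begin
lift_definition zero_hahn :: "'a hahn" is "\<lambda>_. 0" by simp
instance ..
end

instantiation hahn :: (ab_group_add) ab_group_add
begin

lift_definition plus_hahn :: "'a hahn \<Rightarrow> 'a hahn \<Rightarrow> 'a hahn" is "\<lambda>f g e. f e + g e"
  by (erule (1) well_ordered_subset[OF well_ordered_Un]) auto

lift_definition uminus_hahn :: "'a hahn \<Rightarrow> 'a hahn" is "\<lambda>f e. - f e"
  by simp

lift_definition minus_hahn :: "'a hahn \<Rightarrow> 'a hahn \<Rightarrow> 'a hahn" is "\<lambda>f g e. f e - g e"
  by (erule (1) well_ordered_subset[OF well_ordered_Un]) auto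

instance
  by standard (transfer, simp add: fun_eq_iff algebra_simps)+

end

text \<open>The index set of the convolution sum is finite because both supports are well-ordered
  (lemma \<open>finite_well_ordered_decomp\<close>).\<close>

definition hahn_conv :: "(real \<Rightarrow> 'a::comm_ring_1) \<Rightarrow> (real \<Rightarrow> 'a) \<Rightarrow> real \<Rightarrow> 'a" where
  "hahn_conv f g e = (\<Sum>x | f x \<noteq> 0 \<and> g (e - x) \<noteq> 0. f x * g (e - x))"

lemma finite_conv:
  assumes "well_ordered {e. f e \<noteq> 0}" "well_ordered {e. g e \<noteq> 0}"
  shows "finite {x. f x \<noteq> 0 \<and> g (e - x) \<noteq> 0}"
  using finite_well_ordered_decomp[OF assms] by simp

lemma conv_superset:
  assumes "finite A" "{x. f x \<noteq> 0 \<and> g (e - x) \<noteq> 0} \<subseteq> A"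
  shows "hahn_conv f g e = (\<Sum>x\<in>A. f x * g (e - x))"
  unfolding hahn_conv_def by (rule sum.mono_neutral_left) (use assms in auto)

lemma conv_nonzeroD:
  assumes "hahn_conv f g e \<noteq> 0"
  shows "\<exists>x. f x \<noteq> 0 \<and> g (e - x) \<noteq> 0"
proof (rule ccontr)
  assume "\<not> ?thesis"
  then have "{x. f x \<noteq> 0 \<and> g (e - x) \<noteq> 0} = {}" by blast
  then have "hahn_conv f g e = 0" unfolding hahn_conv_def by (simp only: sum.empty)
  then show False using assms by contradiction
qed

lemma well_ordered_conv:
  assumes "well_ordered {e. f e \<noteq> 0}" "well_ordered {e. g e \<noteq> 0}"
  shows "well_ordered {e. hahn_conv f g e \<noteq> 0}"
proof (rule well_ordered_subset[OF well_ordered_sumset[OF assms]], rule subsetI)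
  fix e assume "e \<in> {e. hahn_conv f g e \<noteq> 0}"
  then obtain x where "f x \<noteq> 0" "g (e - x) \<noteq> 0" using conv_nonzeroD by blast
  then show "e \<in> {x + y |x y. x \<in> {e. f e \<noteq> 0} \<and> y \<in> {e. g e \<noteq> 0}}"
    by (intro sumsetI) auto
qed

lemma conv_commute: "hahn_conv f g = hahn_conv g f"
proof
  fix e
  show "hahn_conv f g e = hahn_conv g f e"
    unfolding hahn_conv_def
    by (rule sum.reindex_bij_witness[of _ "\<lambda>x. e - x" "\<lambda>x. e - x"]) (auto simp: mult.commute)
qed

lemma conv_add_left:
  assumes "well_ordered {e. f e \<noteq> 0}" "well_ordered {e. f' e \<noteq> 0}" "well_ordered {e. g e \<noteq> 0}"
  shows "hahn_conv (\<lambda>e. f e + f' e) g e = hahn_conv f g e + hahn_conv f' g e"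
proof -
  let ?A = "{x. f x \<noteq> 0 \<and> g (e - x) \<noteq> 0} \<union> {x. f' x \<noteq> 0 \<and> g (e - x) \<noteq> 0}"
  have fin: "finite ?A" using assms by (simp add: finite_conv)
  have "hahn_conv (\<lambda>e. f e + f' e) g e = (\<Sum>x\<in>?A. (f x + f' x) * g (e - x))"
    by (rule conv_superset[OF fin]) auto
  also have "\<dots> = (\<Sum>x\<in>?A. f x * g (e - x)) + (\<Sum>x\<in>?A. f' x * g (e - x))"
    by (simp add: distrib_right sum.distrib)
  also have "(\<Sum>x\<in>?A. f x * g (e - x)) = hahn_conv f g e"
    by (rule conv_superset[OF fin, symmetric]) auto
  also have "(\<Sum>x\<in>?A. f' x * g (e - x)) = hahn_conv f' g e"
    by (rule conv_superset[OF fin, symmetric]) auto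
  finally show ?thesis .
qed

lemma conv_assoc:
  assumes f: "well_ordered {e. f e \<noteq> 0}" and g: "well_ordered {e. g e \<noteq> 0}"
    and h: "well_ordered {e. h e \<noteq> 0}"
  shows "hahn_conv (hahn_conv f g) h e = hahn_conv f (hahn_conv g h) e"
proof -
  define SFG where "SFG = {x + y |x y. x \<in> {e. f e \<noteq> 0} \<and> y \<in> {e. g e \<noteq> 0}}"
  define SGH where "SGH = {x + y |x y. x \<in> {e. g e \<noteq> 0} \<and> y \<in> {e. h e \<noteq> 0}}"
  define A where "A = {x. x \<in> SFG \<and> e - x \<in> {e. h e \<noteq> 0}}"
  define B where "B = {x. x \<in> {e. f e \<noteq> 0} \<and> e - x \<in> SGH}"
  define P where "P x = {y. f y \<noteq> 0 \<and> g (x - y) \<noteq> 0}" for x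
  define Q where "Q y = {z. g z \<noteq> 0 \<and> h (e - y - z) \<noteq> 0}" for y
  have finA: "finite A" unfolding A_def SFG_def
    by (intro finite_well_ordered_decomp well_ordered_sumset f g h)
  have finB: "finite B" unfolding B_def SGH_def
    by (intro finite_well_ordered_decomp well_ordered_sumset f g h)
  have finP: "finite (P x)" for x unfolding P_def using f g by (rule finite_conv)
  have finQ: "finite (Q x)" for x unfolding Q_def using g h by (rule finite_conv)
  have memF: "x \<in> SFG" if "f y \<noteq> 0" "g (x - y) \<noteq> 0" for x y
    unfolding SFG_def using that by (intro sumsetI) auto
  have memG: "x \<in> SGH" if "g y \<noteq> 0" "h (x - y) \<noteq> 0" for x y
    unfolding SGH_def using that by (intro sumsetI) auto
  have "hahn_conv (hahn_conv f g) h e = (\<Sum>x\<in>A. hahn_conv f g x * h (e - x))"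
    by (rule conv_superset[OF finA]) (auto simp: A_def dest!: conv_nonzeroD intro: memF)
  also have "\<dots> = (\<Sum>x\<in>A. \<Sum>y\<in>P x. f y * g (x - y) * h (e - x))"
    by (simp add: hahn_conv_def P_def sum_distrib_right)
  also have "\<dots> = (\<Sum>(x, y)\<in>Sigma A P. f y * g (x - y) * h (e - x))"
    by (rule sum.Sigma) (simp_all add: finA finP)
  also have "\<dots> = (\<Sum>(y, z)\<in>Sigma B Q. f y * (g z * h (e - y - z)))"
  proof (rule sum.reindex_bij_witness[of _ "\<lambda>(y, z). (y + z, y)" "\<lambda>(x, y). (y, x - y)"])
    fix p assume "p \<in> Sigma A P"
    then obtain x y where p: "p = (x, y)" "h (e - x) \<noteq> 0" "f y \<noteq> 0" "g (x - y) \<noteq> 0"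
      by (auto simp: A_def P_def)
    then show "(case p of (x, y) \<Rightarrow> (y, x - y)) \<in> Sigma B Q"
      using memG[of "x - y" "e - y"] by (auto simp: B_def Q_def)
  next
    fix p assume "p \<in> Sigma B Q"
    then obtain y z where p: "p = (y, z)" "f y \<noteq> 0" "g z \<noteq> 0" "h (e - y - z) \<noteq> 0"
      by (auto simp: B_def Q_def)
    then show "(case p of (y, z) \<Rightarrow> (y + z, y)) \<in> Sigma A P"
      using memF[of y "y + z"] by (auto simp: A_def P_def diff_diff_eq)
  qed (auto simp: mult.assoc)
  also have "\<dots> = (\<Sum>y\<in>B. \<Sum>z\<in>Q y. f y * (g z * h (e - y - z)))"
    by (rule sum.Sigma[symmetric]) (simp_all add: finB finQ)
  also have "\<dots> = (\<Sum>y\<in>B. f y * hahn_conv g h (e - y))"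
    by (simp add: hahn_conv_def Q_def sum_distrib_left)
  also have "\<dots> = hahn_conv f (hahn_conv g h) e"
    by (rule conv_superset[OF finB, symmetric]) (auto simp: B_def dest!: conv_nonzeroD intro: memG)
  finally show ?thesis .
qed

lift_definition hahn_monom :: "'a::zero \<Rightarrow> real \<Rightarrow> 'a hahn" is "\<lambda>c d e. if e = d then c else 0"
  by (rule well_ordered_subset[OF well_ordered_singleton]) auto

lemma conv_monom_left:
  "hahn_conv (\<lambda>e. if e = d then c else 0) g e = c * g (e - d)"
  by (subst conv_superset[of "{d}"]) auto

instantiation hahn :: (comm_ring_1) comm_ring_1
begin

lift_definition one_hahn :: "'a hahn" is "\<lambda>e. if e = 0 then 1 else 0"
  by (rule well_ordered_subset[OF well_ordered_singleton]) auto

lift_definition times_hahn :: "'a hahn \<Rightarrow> 'a hahn \<Rightarrow> 'a hahn" is hahn_conv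
  by (rule well_ordered_conv)

instance
proof
  fix a b c :: "'a hahn"
  show "a * b * c = a * (b * c)" by transfer (simp add: fun_eq_iff conv_assoc)
  show "a * b = b * a" by transfer (rule conv_commute)
  show "1 * a = a" by transfer (simp add: fun_eq_iff conv_monom_left)
  show "(a + b) * c = a * c + b * c" by transfer (simp add: fun_eq_iff conv_add_left)
  show "(0::'a hahn) \<noteq> 1" by transfer (metis zero_neq_one)
qed

end

lemma hahn_coeff_simps [simp]:
  "hahn_coeff 0 e = 0"
  "hahn_coeff (a + b) e = hahn_coeff a e + hahn_coeff b e"
  "hahn_coeff (c - d) e = hahn_coeff c e - hahn_coeff d e"
  "hahn_coeff (- c) e = - hahn_coeff c e"
  for a b c d :: "'a::ab_group_add hahn"
  by (simp_all add: zero_hahn.rep_eq plus_hahn.rep_eq minus_hahn.rep_eq uminus_hahn.rep_eq)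

lemma coeff_one: "hahn_coeff 1 e = (if e = 0 then 1 else 0)"
  by (simp add: one_hahn.rep_eq)

lemma coeff_monom: "hahn_coeff (hahn_monom c d) e = (if e = d then c else 0)"
  by (simp add: hahn_monom.rep_eq)

lemma coeff_times: "hahn_coeff (a * b) e = hahn_conv (hahn_coeff a) (hahn_coeff b) e"
  by (simp add: times_hahn.rep_eq)

lemma coeff_monom_times: "hahn_coeff (hahn_monom c d * a) e = c * hahn_coeff a (e - d)"
  by (simp add: coeff_times hahn_monom.rep_eq conv_monom_left)

lemma monom_mult: "hahn_monom c d * hahn_monom c' d' = hahn_monom (c * c') (d + d')"
  by (rule hahn_eqI) (auto simp: coeff_monom_times coeff_monom)

lemma monom_one: "hahn_monom 1 0 = 1"
  by (rule hahn_eqI) (simp add: coeff_monom coeff_one)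

lemma coeff_times_cong:
  assumes a: "\<And>x. x < 0 \<Longrightarrow> hahn_coeff a x = 0"
    and bc: "\<And>x. x \<le> e \<Longrightarrow> hahn_coeff b x = hahn_coeff c x"
  shows "hahn_coeff (a * b) e = hahn_coeff (a * c) e"
proof -
  have "hahn_coeff a x * hahn_coeff b (e - x) = hahn_coeff a x * hahn_coeff c (e - x)
      \<and> (hahn_coeff a x \<noteq> 0 \<and> hahn_coeff b (e - x) \<noteq> 0 \<longleftrightarrow> hahn_coeff a x \<noteq> 0 \<and> hahn_coeff c (e - x) \<noteq> 0)" for x
  proof (cases "x < 0")
    case False
    then show ?thesis using bc[of "e - x"] by simp
  qed (simp add: a)
  then show ?thesis unfolding coeff_times hahn_conv_def by simp
qed

lemma coeff_power_below:
  fixes x :: "'a::comm_ring_1 hahn"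
  assumes x: "\<And>e. e < d \<Longrightarrow> hahn_coeff x e = 0"
  shows "e < real n * d \<Longrightarrow> hahn_coeff (x ^ n) e = 0"
proof (induction n arbitrary: e)
  case 0
  then show ?case by (simp add: coeff_one)
next
  case (Suc n)
  show ?case
  proof (rule ccontr)
    assume "hahn_coeff (x ^ Suc n) e \<noteq> 0"
    then obtain u where u: "hahn_coeff x u \<noteq> 0" "hahn_coeff (x ^ n) (e - u) \<noteq> 0"
      by (auto simp: coeff_times dest: conv_nonzeroD)
    then have "u \<ge> d" "e - u \<ge> real n * d" using x Suc.IH not_le by blast+
    then show False using Suc.prems by (simp add: algebra_simps)
  qed
qed

lemma coeff_sum: "hahn_coeff (sum f A) e = (\<Sum>i\<in>A. hahn_coeff (f i) e)"
  for f :: "'i \<Rightarrow> 'a::ab_group_add hahn"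
  by (induction A rule: infinite_finite_induct) auto

text \<open>Since the value group is archimedean, a series of positive order \<open>d\<close> has an \<open>n\<close>-th power
  with support in \<open>[n * d, \<infinity>)\<close>, so the geometric series is coefficientwise finite.\<close>

lemma geometric_inverse:
  fixes x :: "'a::comm_ring_1 hahn"
  assumes d: "d > 0" and x: "\<And>e. e < d \<Longrightarrow> hahn_coeff x e = 0"
  shows "\<exists>y. (1 - x) * y = 1"
proof -
  define N where "N e = nat \<lceil>e / d\<rceil> + 1" for e
  have N: "e < real (N e) * d" for e
  proof -
    have "e / d < real (N e)" unfolding N_def by linarith
    then show ?thesis using d by (simp add: pos_divide_less_eq)
  qed
  define g where "g e = hahn_coeff (\<Sum>n<N e. x ^ n) e" for e
  have g: "g e = hahn_coeff (\<Sum>n<M. x ^ n) e" if M: "e < real M * d" for e M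
  proof -
    have *: "hahn_coeff (\<Sum>n<k. x ^ n) e = hahn_coeff (\<Sum>n<l. x ^ n) e"
      if "e < real k * d" "k \<le> l" for k l
      unfolding coeff_sum
    proof (rule sum.mono_neutral_left)
      show "\<forall>i\<in>{..<l} - {..<k}. hahn_coeff (x ^ i) e = 0"
      proof
        fix i assume "i \<in> {..<l} - {..<k}"
        then have "real k * d \<le> real i * d" using d by simp
        then show "hahn_coeff (x ^ i) e = 0" using that coeff_power_below[OF x] by simp
      qed
    qed (use that in auto)
    show ?thesis unfolding g_def
      using *[of M "N e"] *[of "N e" M] N[of e] M by (metis nle_le)
  qed
  have "well_ordered {e. g e \<noteq> 0}"
    unfolding well_ordered_iff
  proof (intro allI impI)
    fix U assume U: "U \<subseteq> {e. g e \<noteq> 0}" "U \<noteq> {}"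
    then obtain u where u: "u \<in> U" by blast
    have "{e\<in>U. e \<le> u} \<subseteq> supp (\<Sum>n<N u. x ^ n)"
    proof
      fix e assume e: "e \<in> {e\<in>U. e \<le> u}"
      then have "e < real (N u) * d" using N[of u] by simp
      then show "e \<in> supp (\<Sum>n<N u. x ^ n)" using U(1) e g by (auto simp: supp_def)
    qed
    then obtain m where m: "m \<in> {e\<in>U. e \<le> u}" "\<And>e. e \<in> {e\<in>U. e \<le> u} \<Longrightarrow> m \<le> e"
      using well_ordered_min[OF well_ordered_supp] u by blast
    have "m \<le> e" if "e \<in> U" for e using m that by (cases "e \<le> u") auto
    then show "\<exists>m\<in>U. \<forall>e\<in>U. m \<le> e" using m by blast
  qed
  then have cg: "hahn_coeff (Abs_hahn g) = g" by (simp add: Abs_hahn_inverse)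
  have "(1 - x) * Abs_hahn g = 1"
  proof (rule hahn_eqI)
    fix e
    have "hahn_coeff ((1 - x) * Abs_hahn g) e = hahn_coeff ((1 - x) * (\<Sum>n<N e. x ^ n)) e"
    proof (rule coeff_times_cong)
      fix y :: real
      show "hahn_coeff (1 - x) y = 0" if "y < 0" using that d x by (simp add: coeff_one)
      show "hahn_coeff (Abs_hahn g) y = hahn_coeff (\<Sum>n<N e. x ^ n) y" if "y \<le> e"
        using g[of y "N e"] N[of e] that by (simp add: cg)
    qed
    also have "(1 - x) * (\<Sum>n<N e. x ^ n) = 1 - x ^ N e"
      by (simp add: one_diff_power_eq)
    also have "hahn_coeff (1 - x ^ N e) e = hahn_coeff 1 e"
      using coeff_power_below[OF x N] by simp
    finally show "hahn_coeff ((1 - x) * Abs_hahn g) e = hahn_coeff 1 e" .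
  qed
  then show ?thesis ..
qed

lemma ex_inverse:
  fixes a :: "'a::field hahn"
  assumes "a \<noteq> 0"
  shows "\<exists>b. a * b = 1"
proof -
  have "supp a \<noteq> {}" using assms hahn_eqI[of a 0] by (auto simp: supp_def)
  then obtain d where d: "d \<in> supp a" "\<And>e. e \<in> supp a \<Longrightarrow> d \<le> e"
    using well_ordered_min[OF well_ordered_supp] by blast
  define c where "c = hahn_coeff a d"
  have c: "c \<noteq> 0" using d by (simp add: c_def supp_def)
  define x where "x = 1 - hahn_monom (inverse c) (- d) * a"
  have cx: "hahn_coeff x e = (if e = 0 then 1 else 0) - inverse c * hahn_coeff a (e + d)" for e
    by (simp add: x_def coeff_one coeff_monom_times)
  have x0: "hahn_coeff x e = 0" if "e \<le> 0" for e
  proof (cases "e = 0")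
    case True
    then show ?thesis using c by (simp add: cx c_def)
  next
    case False
    then have "e + d \<notin> supp a" using d(2)[of "e + d"] that by auto
    then show ?thesis using False by (simp add: cx supp_def)
  qed
  have "\<exists>\<epsilon>>0. \<forall>e<\<epsilon>. hahn_coeff x e = 0"
  proof (cases "supp x = {}")
    case True
    then show ?thesis by (auto simp: supp_def intro: exI[of _ 1])
  next
    case False
    then obtain m where m: "m \<in> supp x" "\<And>e. e \<in> supp x \<Longrightarrow> m \<le> e"
      using well_ordered_min[OF well_ordered_supp] by blast
    then have "m > 0" using x0[of m] by (force simp: supp_def)
    moreover have "hahn_coeff x e = 0" if "e < m" for e
      using m(2)[of e] that by (auto simp: supp_def)
    ultimately show ?thesis by blast
  qed
  then obtain y where y: "(1 - x) * y = 1" using geometric_inverse by blast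
  then have "a * (hahn_monom (inverse c) (- d) * y) = 1"
    by (simp add: x_def ac_simps)
  then show ?thesis ..
qed

instantiation hahn :: (field) field
begin

definition inverse_hahn :: "'a hahn \<Rightarrow> 'a hahn" where
  "inverse a = (if a = 0 then 0 else (THE b. a * b = 1))" for a :: "'a hahn"

definition divide_hahn :: "'a hahn \<Rightarrow> 'a hahn \<Rightarrow> 'a hahn" where
  "a div b = a * inverse b" for a b :: "'a hahn"

instance
proof
  fix a b :: "'a hahn"
  assume a: "a \<noteq> 0"
  have "\<exists>!b. a * b = 1"
  proof (rule ex_ex1I[OF ex_inverse[OF a]])
    fix b c assume "a * b = 1" "a * c = 1"
    then show "b = c" by (metis mult.assoc mult.commute mult_1)
  qed
  then have "a * (THE b. a * b = 1) = 1" by (rule theI')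
  then show "inverse a * a = 1" using a by (simp add: inverse_hahn_def mult.commute)
qed (simp_all add: inverse_hahn_def divide_hahn_def)

end

section \<open>Degree, minimizing indices and Kapranov rank\<close>

definition deg :: "'a::zero hahn \<Rightarrow> ereal" where
  "deg a = (if a = 0 then \<infinity> else ereal (LEAST e. e \<in> supp a))"

definition deg_vec :: "'a::zero hahn ^ 'm \<Rightarrow> ereal ^ 'm" where
  "deg_vec v = (\<chi> i. deg (v $ i))"

definition deg_mat :: "'a::zero hahn ^ 'n ^ 'm \<Rightarrow> ereal ^ 'n ^ 'm" where
  "deg_mat A = (\<chi> i j. deg (A $ i $ j))"

definition ereal_vec :: "real ^ 'm \<Rightarrow> ereal ^ 'm" where
  "ereal_vec v = (\<chi> i. ereal (v $ i))"

definition ereal_mat :: "real ^ 'n ^ 'm \<Rightarrow> ereal ^ 'n ^ 'm" where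
  "ereal_mat B = (\<chi> i j. ereal (B $ i $ j))"

definition Theta :: "ereal ^ 'm \<Rightarrow> ereal ^ 'm \<Rightarrow> 'm::finite set" where
  "Theta a b = {i. a $ i + b $ i = Min (range (\<lambda>k. a $ k + b $ k))}"

text \<open>The ground field is passed as a type argument. The set of ranks is nonempty
  (lemma \<open>kapranov_rank_attained\<close>), so the least element is the minimum.\<close>

definition kapranov_rank :: "'f::field itself \<Rightarrow> real ^ 'n ^ 'm \<Rightarrow> nat" where
  "kapranov_rank F B =
     (LEAST r. \<exists>A :: 'f hahn ^ 'n ^ 'm.
        (\<forall>i j. A $ i $ j \<noteq> 0) \<and> deg_mat A = ereal_mat B \<and> rank A = r)"

lemma deg_eqI:
  assumes "hahn_coeff a d \<noteq> 0" "\<And>e. e < d \<Longrightarrow> hahn_coeff a e = 0"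
  shows "deg a = ereal d"
proof -
  have "a \<noteq> 0" using assms(1) by (auto simp: zero_hahn.rep_eq)
  moreover have "(LEAST e. e \<in> supp a) = d"
    using assms by (intro Least_equality) (auto simp: supp_def not_le[symmetric])
  ultimately show ?thesis by (simp add: deg_def)
qed

lemma deg_monom: "c \<noteq> 0 \<Longrightarrow> deg (hahn_monom c d) = ereal d"
  by (rule deg_eqI) (simp_all add: coeff_monom)

lemma kapranov_rank_attained:
  fixes B :: "real ^ 'n ^ 'm"
  shows "\<exists>A :: 'f::field hahn ^ 'n ^ 'm. (\<forall>i j. A $ i $ j \<noteq> 0) \<and> deg_mat A = ereal_mat B
    \<and> rank A = kapranov_rank TYPE('f) B"
proof -
  define A where "A = ((\<chi> i j. hahn_monom 1 (B $ i $ j)) :: 'f hahn ^ 'n ^ 'm)"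
  have "\<forall>i j. A $ i $ j \<noteq> 0"
    by (auto simp: A_def dest!: arg_cong[of _ 0 deg] simp: deg_monom) (simp add: deg_def)
  moreover have "deg_mat A = ereal_mat B"
    by (simp add: A_def deg_mat_def ereal_mat_def deg_monom)
  ultimately have "\<exists>r. \<exists>A :: 'f hahn ^ 'n ^ 'm.
        (\<forall>i j. A $ i $ j \<noteq> 0) \<and> deg_mat A = ereal_mat B \<and> rank A = r"
    by blast
  from LeastI_ex[OF this] show ?thesis unfolding kapranov_rank_def by blast
qed

end

theory Submission
  imports Defs
begin

text \<open>Rank at most \<open>5 - 2\<close> is achieved by lifting each column of \<open>B\<close> separately to a vector of the
  left kernel of \<open>A\<close>. For a fixed column \<open>b\<close>, the assumption on the minors says that
  \<open>M p q = a p 1 * a q 2 - a q 1 * a p 2\<close> has degree at least \<open>m\<^sub>1 + m\<^sub>2 - b p - b q\<close>, where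
  \<open>m\<^sub>1, m\<^sub>2\<close> are the two tropical minima, with equality iff one of \<open>p, q\<close> lies in \<open>\<Theta>\<^sub>1\<close> and the other in
  \<open>\<Theta>\<^sub>2\<close>. The cardinality assumptions give two indices \<open>p, q\<close> with this property, such that each of
  them also has it together with some third index. Take \<open>c i = \<xi> i * t\<^bsup>b i\<^esup>\<close> for the other indices
  and solve for \<open>c p, c q\<close> by Cramer's rule. Their degrees are right unless one of two nonzero
  linear forms in \<open>\<xi>\<close> vanishes, and four field elements suffice to choose nonzero \<open>\<xi> i\<close> avoiding
  this.\<close>

section \<open>Degrees\<close>

lemma deg_cases:
  obtains "a = 0" "deg a = \<infinity>"
  | d where "deg a = ereal d" "hahn_coeff a d \<noteq> 0" "\<And>e. e < d \<Longrightarrow> hahn_coeff a e = 0"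
proof (cases "a = 0")
  case True
  then show ?thesis using that(1) by (simp add: deg_def)
next
  case False
  then have "supp a \<noteq> {}"
    using hahn_eqI[of a 0] by (auto simp: supp_def zero_hahn.rep_eq)
  then obtain d where d: "d \<in> supp a" "\<And>e. e \<in> supp a \<Longrightarrow> d \<le> e"
    using well_ordered_min[OF well_ordered_supp] by blast
  have c: "hahn_coeff a d \<noteq> 0" "\<And>e. e < d \<Longrightarrow> hahn_coeff a e = 0"
    using d by (force simp: supp_def)+
  show ?thesis by (rule that(2)[OF deg_eqI[OF c] c])
qed

lemma deg_eq_infinity_iff: "deg a = \<infinity> \<longleftrightarrow> a = 0"
  by (auto simp: deg_def)

lemma deg_not_minfty [simp]: "deg a \<noteq> -\<infinity>"
  by (simp add: deg_def)

lemma deg_eq_ereal_iff: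
  "deg a = ereal d \<longleftrightarrow> hahn_coeff a d \<noteq> 0 \<and> (\<forall>e<d. hahn_coeff a e = 0)"
proof
  assume "deg a = ereal d"
  then show "hahn_coeff a d \<noteq> 0 \<and> (\<forall>e<d. hahn_coeff a e = 0)"
    by (cases a rule: deg_cases) auto
qed (auto intro: deg_eqI)

lemma coeff_below_deg: "ereal d \<le> deg a \<Longrightarrow> e < d \<Longrightarrow> hahn_coeff a e = 0"
  by (cases a rule: deg_cases) (auto simp: zero_hahn.rep_eq)

lemma deg_uminus: "deg (- a) = deg a" for a :: "'a::ab_group_add hahn"
  by (simp add: deg_def supp_def)

text \<open>At exponent \<open>d + d'\<close> the convolution has the single term
  \<open>x = d\<close>, the product of two nonzero leading coefficients; at lower exponents it has
  no terms.\<close>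

lemma deg_mult:
  fixes a b :: "'a::field hahn"
  assumes a: "deg a = ereal d" and b: "deg b = ereal d'"
  shows "deg (a * b) = ereal (d + d')"
proof -
  have zero: "hahn_coeff a e = 0" if "e < d" for e
    using a that by (simp add: deg_eq_ereal_iff)
  have zero': "hahn_coeff b e = 0" if "e < d'" for e
    using b that by (simp add: deg_eq_ereal_iff)
  have "hahn_conv (hahn_coeff a) (hahn_coeff b) (d + d')
      = (\<Sum>x\<in>{d}. hahn_coeff a x * hahn_coeff b (d + d' - x))"
  proof (rule conv_superset)
    show "{x. hahn_coeff a x \<noteq> 0 \<and> hahn_coeff b (d + d' - x) \<noteq> 0} \<subseteq> {d}"
    proof
      fix x assume "x \<in> {x. hahn_coeff a x \<noteq> 0 \<and> hahn_coeff b (d + d' - x) \<noteq> 0}"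
      then have "\<not> x < d" "\<not> d + d' - x < d'" using zero zero' by blast+
      then show "x \<in> {d}" by simp
    qed
  qed simp
  moreover have "hahn_conv (hahn_coeff a) (hahn_coeff b) e = 0" if "e < d + d'" for e
  proof (rule ccontr)
    assume "hahn_conv (hahn_coeff a) (hahn_coeff b) e \<noteq> 0"
    then obtain x where "hahn_coeff a x \<noteq> 0" "hahn_coeff b (e - x) \<noteq> 0"
      using conv_nonzeroD by blast
    then have "\<not> x < d" "\<not> e - x < d'" using zero zero' by blast+
    then show False using that by simp
  qed
  ultimately show ?thesis
    using a b by (simp add: deg_eq_ereal_iff coeff_times)
qed

lemma deg_divide:
  fixes a b :: "'a::field hahn"
  assumes a: "deg a = ereal d" and b: "deg b = ereal d'"
  shows "deg (a / b) = ereal (d - d')"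
proof -
  have nz: "a \<noteq> 0" "b \<noteq> 0" using a b by (auto simp: deg_def)
  then have "a / b \<noteq> 0" by simp
  then obtain r where r: "deg (a / b) = ereal r"
    by (metis deg_cases)
  have "deg (a / b * b) = ereal (r + d')" by (rule deg_mult[OF r b])
  with a nz have "d = r + d'" by simp
  with r show ?thesis by simp
qed

section \<open>Avoiding the zeros of two linear forms\<close>

lemma ex_avoiding_three:
  assumes "infinite (UNIV :: 'a set) \<or> card (UNIV :: 'a set) \<ge> 4"
  shows "\<exists>z :: 'a. z \<noteq> a \<and> z \<noteq> b \<and> z \<noteq> c"
proof (rule ccontr)
  assume "\<not> ?thesis"
  then have eq: "UNIV = set [a, b, c]" by auto
  then have "finite (UNIV :: 'a set)" by (metis List.finite_set)
  moreover have "card (UNIV :: 'a set) \<le> 3" unfolding eq using card_length[of "[a, b, c]"] by simp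
  ultimately show False using assms by simp
qed

text \<open>By induction on \<open>S\<close>: the weight of a new index has to avoid 0 and at most
  one further value for each form, three values in all. The implications let the induction pass
  through sets on which a form is still zero.\<close>

lemma ex_nonzero_weights:
  fixes f g :: "'i \<Rightarrow> 'a::field"
  assumes F: "infinite (UNIV :: 'a set) \<or> card (UNIV :: 'a set) \<ge> 4"
    and "finite S"
  shows "\<exists>\<xi>. (\<forall>i. \<xi> i \<noteq> 0) \<and> ((\<exists>i\<in>S. f i \<noteq> 0) \<longrightarrow> (\<Sum>i\<in>S. \<xi> i * f i) \<noteq> 0)
    \<and> ((\<exists>i\<in>S. g i \<noteq> 0) \<longrightarrow> (\<Sum>i\<in>S. \<xi> i * g i) \<noteq> 0)"
  using \<open>finite S\<close>
proof (induction S rule: finite_induct)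
  case empty
  show ?case by (rule exI[of _ "\<lambda>_. 1"]) simp
next
  case (insert k S)
  then obtain \<xi> where \<xi>: "\<And>i. \<xi> i \<noteq> 0"
      "(\<exists>i\<in>S. f i \<noteq> 0) \<Longrightarrow> (\<Sum>i\<in>S. \<xi> i * f i) \<noteq> 0"
      "(\<exists>i\<in>S. g i \<noteq> 0) \<Longrightarrow> (\<Sum>i\<in>S. \<xi> i * g i) \<noteq> 0"
    by blast
  \<comment> \<open>If \<open>f k = 0\<close> or \<open>g k = 0\<close>, division by zero gives 0,
    so that condition only repeats \<open>z \<noteq> 0\<close>.\<close>
  obtain z where z: "z \<noteq> 0" "z \<noteq> - (\<Sum>i\<in>S. \<xi> i * f i) / f k" "z \<noteq> - (\<Sum>i\<in>S. \<xi> i * g i) / g k"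
    using ex_avoiding_three[OF F] by blast
  have sum: "(\<Sum>i\<in>insert k S. (\<xi>(k := z)) i * h i) = z * h k + (\<Sum>i\<in>S. \<xi> i * h i)" for h
  proof -
    have "(\<Sum>i\<in>S. (\<xi>(k := z)) i * h i) = (\<Sum>i\<in>S. \<xi> i * h i)"
      using insert.hyps by (intro sum.cong) auto
    then show ?thesis using insert.hyps by simp
  qed
  have nz: "z * h k + (\<Sum>i\<in>S. \<xi> i * h i) \<noteq> 0"
    if "(\<exists>i\<in>S. h i \<noteq> 0) \<Longrightarrow> (\<Sum>i\<in>S. \<xi> i * h i) \<noteq> 0" "z \<noteq> - (\<Sum>i\<in>S. \<xi> i * h i) / h k"
      "\<exists>i\<in>insert k S. h i \<noteq> 0" for h
  proof (cases "h k = 0")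
    case False
    then show ?thesis using that(2) by (simp add: field_simps eq_neg_iff_add_eq_0)
  qed (use that in auto)
  show ?case
  proof (intro exI[of _ "\<xi>(k := z)"] conjI impI)
    show "\<forall>i. (\<xi>(k := z)) i \<noteq> 0" using \<xi>(1) z(1) by simp
  qed (unfold sum, (rule nz; use \<xi> z in blast)+)
qed

section \<open>Choice of the two eliminated indices\<close>

text \<open>For \<open>S\<close>, \<open>T\<close> the two minimizing sets, the minor of a crossing
  pair of rows attains the least degree that the tropical minima allow.\<close>

definition crossing :: "'a set \<Rightarrow> 'a set \<Rightarrow> 'a \<Rightarrow> 'a \<Rightarrow> bool" where
  "crossing S T i j \<longleftrightarrow> i \<noteq> j \<and> (i \<in> S \<and> j \<in> T \<or> j \<in> S \<and> i \<in> T)"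

lemma card_ge_2_ex_other:
  assumes "card S \<ge> 2"
  shows "\<exists>y\<in>S. y \<noteq> x"
proof (rule ccontr)
  assume "\<not> ?thesis"
  then have "S \<subseteq> {x}" by blast
  then have "card S \<le> 1" using card_mono[of "{x}" S] by simp
  then show False using assms by simp
qed

lemma card_ge_3_ex_other:
  assumes "card S \<ge> 3"
  shows "\<exists>z\<in>S. z \<noteq> x \<and> z \<noteq> y"
proof (rule ccontr)
  assume "\<not> ?thesis"
  then have "S \<subseteq> {x, y}" by blast
  then have "card S \<le> card {x, y}" using card_mono[of "{x, y}" S] by simp
  also have "\<dots> \<le> 2" by (simp add: card_insert_if)
  finally show False using assms by simp
qed

text \<open>If one set contains the other, \<open>p\<close> and \<open>q\<close> come from the
  smaller one and \<open>i = j\<close> is a third element of the union. Otherwise \<open>p\<close>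
  and \<open>q\<close> come from the two set differences, \<open>i\<close> is another element of
  \<open>S\<close> and \<open>j\<close> another element of \<open>T\<close>.\<close>

lemma ex_crossing:
  assumes "card S \<ge> 2" "card T \<ge> 2" "card (S \<union> T) \<ge> 3"
  obtains p q i j where "crossing S T p q" "crossing S T i q" "crossing S T j p"
    "i \<notin> {p, q}" "j \<notin> {p, q}"
proof -
  have nested: "\<exists>p q i. crossing S T p q \<and> crossing S T i q \<and> crossing S T i p \<and> i \<notin> {p, q}"
    if T: "card T \<ge> 2" and ST: "card (S \<union> T) \<ge> 3" and "T \<subseteq> S" for S T :: "'a set"
  proof -
    have "T \<noteq> {}" using T by auto
    then obtain p where p: "p \<in> T" by blast
    obtain q where q: "q \<in> T" "q \<noteq> p" using card_ge_2_ex_other[OF T] by blast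
    obtain i where i: "i \<in> S \<union> T" "i \<noteq> p" "i \<noteq> q" using card_ge_3_ex_other[OF ST] by blast
    have "crossing S T p q \<and> crossing S T i q \<and> crossing S T i p \<and> i \<notin> {p, q}"
      using p q i \<open>T \<subseteq> S\<close> unfolding crossing_def by blast
    then show ?thesis by blast
  qed
  have swap: "crossing T S = crossing S T" by (auto simp: crossing_def fun_eq_iff)
  consider "T \<subseteq> S" | "S \<subseteq> T" | p q where "p \<in> S" "p \<notin> T" "q \<in> T" "q \<notin> S" by blast
  then show thesis
  proof cases
    case 1
    then show thesis using nested[of T S] assms that by blast
  next
    case 2
    then show thesis using nested[of S T] assms that by (metis Un_commute swap)
  next
    case 3
    obtain i where i: "i \<in> S" "i \<noteq> p" using card_ge_2_ex_other[OF assms(1)] by blast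
    obtain j where j: "j \<in> T" "j \<noteq> q" using card_ge_2_ex_other[OF assms(2)] by blast
    show thesis
      by (rule that[of p q i j]) (use 3 i j in \<open>auto simp: crossing_def\<close>)
  qed
qed

section \<open>Lifting one column\<close>

text \<open>The tropical estimate of a 2 x 2 minor: \<open>u\<close>, \<open>v\<close> are the
  degrees of the entries in one row, \<open>u'\<close>, \<open>v'\<close> in the other. Extended
  reals are kept because entries may vanish.\<close>

lemma min_ereal_add_bounds:
  fixes u u' v v' :: ereal and m n b b' :: real
  assumes u: "ereal m \<le> u + ereal b" "ereal m \<le> u' + ereal b'"
    and v: "ereal n \<le> v + ereal b" "ereal n \<le> v' + ereal b'"
  shows "ereal (m + n - b - b') \<le> min (u + v') (u' + v)"
    and "u + ereal b = ereal m \<and> v' + ereal b' = ereal n \<or>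
      u' + ereal b' = ereal m \<and> v + ereal b = ereal n \<Longrightarrow>
      min (u + v') (u' + v) = ereal (m + n - b - b')"
proof -
  have le: "ereal (r - s) \<le> x" if "ereal r \<le> x + ereal s" for r s x
    using that by (cases x) auto
  have eq: "x = ereal (r - s)" if "x + ereal s = ereal r" for r s x
    using that by (cases x) auto
  show ge: "ereal (m + n - b - b') \<le> min (u + v') (u' + v)"
    using add_mono[OF le[OF u(1)] le[OF v(2)]] add_mono[OF le[OF u(2)] le[OF v(1)]]
    by (simp add: algebra_simps)
  assume "u + ereal b = ereal m \<and> v' + ereal b' = ereal n \<or>
      u' + ereal b' = ereal m \<and> v + ereal b = ereal n"
  then have "u + v' = ereal (m + n - b - b') \<or> u' + v = ereal (m + n - b - b')"
    by (auto dest!: eq)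
  with ge show "min (u + v') (u' + v) = ereal (m + n - b - b')"
    by (auto simp: min_def)
qed

text \<open>The kernel conditions involve one column at a time, so each column \<open>b\<close> is
  lifted on its own. \<open>S\<close> and \<open>T\<close> are its two \<open>Theta\<close> sets,
  with the minima given as reals.\<close>

lemma ex_kernel_vector:
  fixes u v :: "'m::finite \<Rightarrow> 'f::field hahn" and b :: "'m \<Rightarrow> real" and m\<^sub>1 m\<^sub>2 :: real
  defines "S \<equiv> {i. deg (u i) + ereal (b i) = ereal m\<^sub>1}"
    and "T \<equiv> {i. deg (v i) + ereal (b i) = ereal m\<^sub>2}"
  assumes F: "infinite (UNIV :: 'f set) \<or> card (UNIV :: 'f set) \<ge> 4"
    and minors: "\<And>p q. p \<noteq> q \<Longrightarrow>
      deg (u p * v q - u q * v p) = min (deg (u p) + deg (v q)) (deg (u q) + deg (v p))"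
    and m1: "\<And>i. ereal m\<^sub>1 \<le> deg (u i) + ereal (b i)"
    and m2: "\<And>i. ereal m\<^sub>2 \<le> deg (v i) + ereal (b i)"
    and card: "card S \<ge> 2" "card T \<ge> 2" "card (S \<union> T) \<ge> 3"
  shows "\<exists>c. (\<forall>i. deg (c i) = ereal (b i)) \<and> (\<Sum>i\<in>UNIV. u i * c i) = 0 \<and> (\<Sum>i\<in>UNIV. v i * c i) = 0"
proof -
  define M where "M p q = u p * v q - u q * v p" for p q
  define d where "d p q = m\<^sub>1 + m\<^sub>2 - b p - b q" for p q
  have M_ge: "ereal (d p q) \<le> deg (M p q)" if "p \<noteq> q" for p q
    unfolding M_def d_def minors[OF that] by (rule min_ereal_add_bounds(1)) (rule m1 m2)+
  have M_eq: "deg (M p q) = ereal (d p q)" if "crossing S T p q" for p q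
  proof -
    from that have "p \<noteq> q" by (simp add: crossing_def)
    then show ?thesis
      unfolding M_def d_def minors[OF \<open>p \<noteq> q\<close>]
      using that by (intro min_ereal_add_bounds(2)) (auto simp: m1 m2 crossing_def S_def T_def)
  qed
  \<comment> \<open>The index \<open>k\<close> makes the linear form belonging to \<open>N q\<close>
    nonzero, and \<open>l\<close> the one belonging to \<open>N p\<close>.\<close>
  obtain p q k l where pq: "crossing S T p q"
    and k: "crossing S T k q" "k \<notin> {p, q}" and l: "crossing S T l p" "l \<notin> {p, q}"
    using ex_crossing[OF card] by metis
  have "p \<noteq> q" using pq by (simp add: crossing_def)
  define R where "R = UNIV - {p, q}"
  have klR: "k \<in> R" "l \<in> R" using k l by (auto simp: R_def)
  obtain \<xi> where \<xi>: "\<And>i. \<xi> i \<noteq> 0"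
    "(\<exists>i\<in>R. hahn_coeff (M i q) (d i q) \<noteq> 0) \<Longrightarrow> (\<Sum>i\<in>R. \<xi> i * hahn_coeff (M i q) (d i q)) \<noteq> 0"
    "(\<exists>i\<in>R. hahn_coeff (M i p) (d i p) \<noteq> 0) \<Longrightarrow> (\<Sum>i\<in>R. \<xi> i * hahn_coeff (M i p) (d i p)) \<noteq> 0"
    using ex_nonzero_weights[OF F, of R "\<lambda>i. hahn_coeff (M i q) (d i q)" "\<lambda>i. hahn_coeff (M i p) (d i p)"]
    by auto
  define x where "x i = hahn_monom (\<xi> i) (b i)" for i
  define N where "N r = (\<Sum>i\<in>R. x i * M i r)" for r
  \<comment> \<open>No summand starts below
    \<open>b i + d i r = m\<^sub>1 + m\<^sub>2 - b r\<close>, a bound independent of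
    \<open>i\<close>. The coefficient of \<open>N r\<close> there is the linear form in
    \<open>\<xi>\<close>.\<close>
  have N_deg: "deg (N r) = ereal (m\<^sub>1 + m\<^sub>2 - b r)"
    if "r \<notin> R" "(\<Sum>i\<in>R. \<xi> i * hahn_coeff (M i r) (d i r)) \<noteq> 0" for r
  proof (rule deg_eqI)
    have coeff: "hahn_coeff (N r) e = (\<Sum>i\<in>R. \<xi> i * hahn_coeff (M i r) (e - b i))" for e
      by (simp add: N_def coeff_sum x_def coeff_monom_times)
    have "hahn_coeff (N r) (m\<^sub>1 + m\<^sub>2 - b r) = (\<Sum>i\<in>R. \<xi> i * hahn_coeff (M i r) (d i r))"
      unfolding coeff d_def by (intro sum.cong) (simp_all add: algebra_simps)
    then show "hahn_coeff (N r) (m\<^sub>1 + m\<^sub>2 - b r) \<noteq> 0" using that(2) by simp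
    show "hahn_coeff (N r) e = 0" if e: "e < m\<^sub>1 + m\<^sub>2 - b r" for e
      unfolding coeff
    proof (intro sum.neutral ballI)
      fix i assume "i \<in> R"
      then have "i \<noteq> r" using \<open>r \<notin> R\<close> by blast
      have "hahn_coeff (M i r) (e - b i) = 0"
        using e by (intro coeff_below_deg[OF M_ge[OF \<open>i \<noteq> r\<close>]]) (simp add: d_def)
      then show "\<xi> i * hahn_coeff (M i r) (e - b i) = 0" by simp
    qed
  qed
  have Nq: "deg (N q) = ereal (m\<^sub>1 + m\<^sub>2 - b q)"
  proof (rule N_deg)
    show "(\<Sum>i\<in>R. \<xi> i * hahn_coeff (M i q) (d i q)) \<noteq> 0"
      using \<xi>(2) klR(1) M_eq[OF k(1)] by (auto simp: deg_eq_ereal_iff)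
  qed (simp add: R_def)
  have Np: "deg (N p) = ereal (m\<^sub>1 + m\<^sub>2 - b p)"
  proof (rule N_deg)
    show "(\<Sum>i\<in>R. \<xi> i * hahn_coeff (M i p) (d i p)) \<noteq> 0"
      using \<xi>(3) klR(2) M_eq[OF l(1)] by (auto simp: deg_eq_ereal_iff)
  qed (simp add: R_def)
  \<comment> \<open>Weighting the two equations by \<open>v q\<close> and \<open>- u q\<close>
    eliminates \<open>c q\<close> and leaves \<open>M p q * c p + N q = 0\<close>. Eliminating
    \<open>c p\<close> instead gives \<open>c q\<close>, with the opposite sign since
    \<open>M q p = - M p q\<close>.\<close>
  define c where "c i = (if i = p then - (N q / M p q) else if i = q then N p / M p q else x i)" for i
  have Mpq: "M p q \<noteq> 0" using M_eq[OF pq] deg_eq_infinity_iff[of "M p q"] by auto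
  have "deg (c i) = ereal (b i)" for i
  proof -
    have "deg (c p) = ereal (b p)"
      using deg_divide[OF Nq M_eq[OF pq]] by (simp add: c_def deg_uminus d_def)
    moreover have "deg (c q) = ereal (b q)"
      using deg_divide[OF Np M_eq[OF pq]] \<open>p \<noteq> q\<close> by (simp add: c_def d_def)
    moreover have "deg (c i) = ereal (b i)" if "i \<noteq> p" "i \<noteq> q"
      using that \<xi>(1) by (simp add: c_def x_def deg_monom)
    ultimately show ?thesis by metis
  qed
  \<comment> \<open>The relation assumed of \<open>w\<close> says that the 3 x 3 determinant with
    rows \<open>w\<close>, \<open>u\<close>, \<open>v\<close> and columns \<open>p\<close>,
    \<open>i\<close>, \<open>q\<close> vanishes. For \<open>w = u\<close> and \<open>w = v\<close>
    two rows coincide.\<close>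
  moreover have kernel: "(\<Sum>i\<in>UNIV. w i * c i) = 0"
    if pluecker: "\<And>i. w p * M i q = w q * M i p + w i * M p q" for w
  proof -
    have "UNIV = insert p (insert q R)" "p \<notin> insert q R" "q \<notin> R"
      using \<open>p \<noteq> q\<close> by (auto simp: R_def)
    then have "(\<Sum>i\<in>UNIV. w i * c i) = w p * c p + (\<Sum>i\<in>insert q R. w i * c i)"
      using sum.insert[of "insert q R" p "\<lambda>i. w i * c i"] by simp
    also have "\<dots> = w p * c p + w q * c q + (\<Sum>i\<in>R. w i * c i)"
      using \<open>q \<notin> R\<close> by (simp add: add.assoc)
    also have "(\<Sum>i\<in>R. w i * c i) = (\<Sum>i\<in>R. w i * x i)"
      by (intro sum.cong) (auto simp: c_def R_def)
    also have "w p * c p + w q * c q + \<dots> = 0"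
    proof -
      have "w p * N q = w q * N p + (\<Sum>i\<in>R. w i * x i) * M p q"
        unfolding N_def sum_distrib_left sum_distrib_right sum.distrib[symmetric]
      proof (intro sum.cong refl)
        fix i
        show "w p * (x i * M i q) = w q * (x i * M i p) + w i * x i * M p q"
          using arg_cong[OF pluecker[of i], of "(*) (x i)"] by (simp add: algebra_simps)
      qed
      then show ?thesis using Mpq \<open>p \<noteq> q\<close> by (simp add: c_def field_simps)
    qed
    finally show ?thesis .
  qed
  moreover have "(\<Sum>i\<in>UNIV. u i * c i) = 0" "(\<Sum>i\<in>UNIV. v i * c i) = 0"
    by (rule kernel, simp add: M_def algebra_simps)+
  ultimately show ?thesis by blast
qed

section \<open>Rank\<close>

text \<open>If all minors vanish, every row is a multiple of one fixed row, chosen nonzero when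
  there is one, so the row space has dimension at most 1.\<close>

lemma rank_2_ex_minor:
  fixes A :: "'a::field ^ 2 ^ 'm"
  assumes "rank A = 2"
  shows "\<exists>p q. A $ p $ 1 * A $ q $ 2 - A $ q $ 1 * A $ p $ 2 \<noteq> 0"
proof (rule ccontr)
  assume "\<not> ?thesis"
  then have minor: "A $ p $ 1 * A $ q $ 2 = A $ q $ 1 * A $ p $ 2" for p q by simp
  have "\<exists>p. \<forall>i. \<exists>k. A $ i = k *s A $ p"
  proof (cases "\<exists>p. A $ p \<noteq> 0")
    case True
    then obtain p where "A $ p \<noteq> 0" by blast
    then consider "A $ p $ 1 \<noteq> 0" | "A $ p $ 2 \<noteq> 0" by (auto simp: vec_eq_iff forall_2)
    then show ?thesis
    proof cases
      case 1
      then have "A $ i = (A $ i $ 1 / A $ p $ 1) *s A $ p" for i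
        using minor[of p i] by (simp add: vec_eq_iff forall_2 field_simps)
      then show ?thesis by blast
    next
      case 2
      then have "A $ i = (A $ i $ 2 / A $ p $ 2) *s A $ p" for i
        using minor[of p i] by (simp add: vec_eq_iff forall_2 field_simps)
      then show ?thesis by blast
    qed
  next
    case False
    then show ?thesis by (metis vec.scale_zero_left)
  qed
  then obtain p where p: "\<And>i. \<exists>k. A $ i = k *s A $ p" by blast
  have "rows A \<subseteq> vec.span {A $ p}"
  proof
    fix r assume "r \<in> rows A"
    then obtain i where "r = A $ i" by (auto simp: rows_def row_def)
    with p[of i] show "r \<in> vec.span {A $ p}"
      by (metis insertI1 vec.span_base vec.span_scale)
  qed
  then have "vec.dim (rows A) \<le> 1" using vec.dim_le_card[of "rows A" "{A $ p}"] by simp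
  then show False using assms by (simp add: row_rank_def_gen)
qed

text \<open>The two relations among the rows can be solved for rows \<open>p\<close> and
  \<open>q\<close>, so the remaining rows span the row space.\<close>

lemma rank_le_if_left_kernel:
  fixes C :: "'a::field ^ 'n ^ 'm::finite" and u v :: "'m \<Rightarrow> 'a"
  assumes u: "\<And>j. (\<Sum>i\<in>UNIV. u i * C $ i $ j) = 0"
    and v: "\<And>j. (\<Sum>i\<in>UNIV. v i * C $ i $ j) = 0"
    and minor: "u p * v q - u q * v p \<noteq> 0"
  shows "rank C \<le> CARD('m) - 2"
proof -
  define M where "M p q = u p * v q - u q * v p" for p q
  have "p \<noteq> q" using minor by auto
  define R where "R = UNIV - {p, q}"
  have fin: "finite (($) C ` R)" by simp
  \<comment> \<open>Stated for \<open>r\<close>, \<open>s\<close> so that it serves both orders of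
    \<open>p\<close> and \<open>q\<close>.\<close>
  have elim: "C $ r \<in> vec.span (($) C ` R)"
    if "UNIV = insert r (insert s R)" "r \<noteq> s" "r \<notin> R" "s \<notin> R" "M r s \<noteq> 0" for r s
  proof -
    have "C $ r = (\<Sum>i\<in>R. (- M i s / M r s) *s C $ i)"
      unfolding vec_eq_iff
    proof
      fix j
      \<comment> \<open>With these weights row \<open>i\<close> gets coefficient
        \<open>M i s\<close>; row \<open>s\<close> drops out because
        \<open>M s s = 0\<close>.\<close>
      have "0 = v s * (\<Sum>i\<in>UNIV. u i * C $ i $ j) - u s * (\<Sum>i\<in>UNIV. v i * C $ i $ j)"
        by (simp add: u v)
      also have "\<dots> = (\<Sum>i\<in>UNIV. M i s * C $ i $ j)"
        by (simp add: M_def sum_distrib_left sum_subtractf[symmetric] algebra_simps)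
      also have "\<dots> = M r s * C $ r $ j + (\<Sum>i\<in>R. M i s * C $ i $ j)"
        unfolding that(1) using that(2-4) by (simp add: M_def)
      finally have "M r s * C $ r $ j = - (\<Sum>i\<in>R. M i s * C $ i $ j)"
        by (simp add: eq_neg_iff_add_eq_0)
      then have "C $ r $ j = - (\<Sum>i\<in>R. M i s * C $ i $ j) / M r s"
        using that(5) by (simp add: field_simps)
      then show "C $ r $ j = (\<Sum>i\<in>R. (- M i s / M r s) *s C $ i) $ j"
        by (simp add: sum_divide_distrib sum_negf)
    qed
    moreover have "\<dots> \<in> vec.span (($) C ` R)"
      by (intro vec.span_sum vec.span_scale vec.span_base) simp
    ultimately show ?thesis by simp
  qed
  have "rows C \<subseteq> vec.span (($) C ` R)"
  proof
    fix r assume "r \<in> rows C"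
    then obtain i where i: "r = C $ i" by (auto simp: rows_def row_def)
    have "C $ p \<in> vec.span (($) C ` R)"
      by (rule elim[of p q]) (use \<open>p \<noteq> q\<close> minor in \<open>auto simp: R_def M_def\<close>)
    moreover have "C $ q \<in> vec.span (($) C ` R)"
      by (rule elim[of q p]) (use \<open>p \<noteq> q\<close> minor in \<open>auto simp: R_def M_def\<close>)
    moreover have "C $ i \<in> vec.span (($) C ` R)" if "i \<in> R"
      using that by (intro vec.span_base) simp
    ultimately show "r \<in> vec.span (($) C ` R)" unfolding i R_def by blast
  qed
  then have "rank C \<le> card (($) C ` R)"
    unfolding row_rank_def_gen by (rule vec.dim_le_card[OF _ fin])
  also have "\<dots> \<le> card R" by (rule card_image_le) simp
  also have "\<dots> = CARD('m) - 2" using \<open>p \<noteq> q\<close> by (simp add: R_def card_Diff_subset)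
  finally show ?thesis .
qed

text \<open>A nonzero entry keeps the minimum below infinity and no degree is negative infinity, so
  the minimum is real even when other entries of the column vanish.\<close>

lemma Theta_columns:
  fixes A :: "'f::field hahn ^ 'k ^ 'm::finite" and B :: "real ^ 'n ^ 'm"
  assumes "\<exists>i. A $ i $ k \<noteq> 0"
  shows "\<exists>m. (\<forall>i. ereal m \<le> deg (A $ i $ k) + ereal (B $ i $ j)) \<and>
    Theta (deg_vec (column k A)) (ereal_vec (column j B))
      = {i. deg (A $ i $ k) + ereal (B $ i $ j) = ereal m}"
proof -
  define R where "R = range (\<lambda>i. deg (A $ i $ k) + ereal (B $ i $ j))"
  have R: "finite R" "R \<noteq> {}" by (auto simp: R_def)
  have le: "Min R \<le> deg (A $ i $ k) + ereal (B $ i $ j)" for i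
    by (rule Min_le[OF R(1)]) (simp add: R_def)
  obtain i where i: "A $ i $ k \<noteq> 0" using assms by blast
  then have "deg (A $ i $ k) + ereal (B $ i $ j) \<noteq> \<infinity>" by (simp add: deg_eq_infinity_iff)
  then have "Min R \<noteq> \<infinity>" using le[of i] by auto
  moreover obtain i' where "Min R = deg (A $ i' $ k) + ereal (B $ i' $ j)"
    using Min_in[OF R] unfolding R_def by (rule rangeE)
  then have "Min R \<noteq> -\<infinity>" by simp
  ultimately obtain m where m: "Min R = ereal m" by (cases "Min R") auto
  show ?thesis
    by (rule exI[of _ m])
      (use le m in \<open>simp_all add: Theta_def deg_vec_def ereal_vec_def column_def R_def[symmetric]\<close>)
qed

text \<open>The lifted columns form a matrix of degree \<open>B\<close> annihilated from the left by
  both columns of \<open>A\<close>. A nonzero minor of \<open>A\<close> makes its rank drop by two,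
  and this rank bounds the minimum over all lifts of \<open>B\<close>.\<close>

lemma kapranov_rank_le:
  fixes A :: "'f::field hahn ^ 2 ^ 'm::finite"
    and B :: "real ^ 'n::finite ^ 'm"
  assumes F: "infinite (UNIV :: 'f set) \<or> card (UNIV :: 'f set) \<ge> 4"
    and rank: "rank A = 2"
    and minors: "\<And>p q. p \<noteq> q \<Longrightarrow>
      deg (A $ p $ 1 * A $ q $ 2 - A $ q $ 1 * A $ p $ 2)
        = min (deg (A $ p $ 1) + deg (A $ q $ 2)) (deg (A $ q $ 1) + deg (A $ p $ 2))"
    and card1: "\<And>j. card (Theta (deg_vec (column 1 A)) (ereal_vec (column j B))) \<ge> 2"
    and card2: "\<And>j. card (Theta (deg_vec (column 2 A)) (ereal_vec (column j B))) \<ge> 2"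
    and card3: "\<And>j. card (Theta (deg_vec (column 1 A)) (ereal_vec (column j B))
      \<union> Theta (deg_vec (column 2 A)) (ereal_vec (column j B))) \<ge> 3"
  shows "kapranov_rank TYPE('f) B \<le> CARD('m) - 2"
proof -
  obtain p q where pq: "A $ p $ 1 * A $ q $ 2 - A $ q $ 1 * A $ p $ 2 \<noteq> 0"
    using rank_2_ex_minor[OF rank] by blast
  \<comment> \<open>A zero column would make every minor vanish.\<close>
  have col: "\<exists>i. A $ i $ 1 \<noteq> 0" "\<exists>i. A $ i $ 2 \<noteq> 0"
    using pq by (metis diff_self mult_zero_left mult_zero_right)+
  have "\<exists>c. (\<forall>i. deg (c i) = ereal (B $ i $ j)) \<and> (\<Sum>i\<in>UNIV. A $ i $ 1 * c i) = 0
      \<and> (\<Sum>i\<in>UNIV. A $ i $ 2 * c i) = 0" for j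
  proof -
    obtain m\<^sub>1 where m1: "\<forall>i. ereal m\<^sub>1 \<le> deg (A $ i $ 1) + ereal (B $ i $ j)"
      "Theta (deg_vec (column 1 A)) (ereal_vec (column j B))
        = {i. deg (A $ i $ 1) + ereal (B $ i $ j) = ereal m\<^sub>1}"
      using Theta_columns[OF col(1), of B j] by blast
    obtain m\<^sub>2 where m2: "\<forall>i. ereal m\<^sub>2 \<le> deg (A $ i $ 2) + ereal (B $ i $ j)"
      "Theta (deg_vec (column 2 A)) (ereal_vec (column j B))
        = {i. deg (A $ i $ 2) + ereal (B $ i $ j) = ereal m\<^sub>2}"
      using Theta_columns[OF col(2), of B j] by blast
    show ?thesis
      by (rule ex_kernel_vector[OF F minors m1(1)[rule_format] m2(1)[rule_format]
            card1[of j, unfolded m1(2)] card2[of j, unfolded m2(2)] card3[of j, unfolded m1(2) m2(2)]])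
  qed
  then obtain c where c: "\<And>j i. deg (c j i) = ereal (B $ i $ j)"
    "\<And>j. (\<Sum>i\<in>UNIV. A $ i $ 1 * c j i) = 0" "\<And>j. (\<Sum>i\<in>UNIV. A $ i $ 2 * c j i) = 0"
    by metis
  define C :: "'f hahn ^ 'n ^ 'm" where "C = (\<chi> i j. c j i)"
  have "rank C \<le> CARD('m) - 2"
    by (rule rank_le_if_left_kernel[OF _ _ pq]) (simp_all add: C_def c)
  moreover have "kapranov_rank TYPE('f) B \<le> rank C"
    unfolding kapranov_rank_def
  proof (intro Least_le exI[of _ C] conjI refl allI)
    fix i j
    show "C $ i $ j \<noteq> 0"
      using c(1)[of j i] deg_eq_infinity_iff[of "c j i"] by (auto simp: C_def)
    show "deg_mat C = ereal_mat B"
      by (simp add: deg_mat_def ereal_mat_def C_def c(1))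
  qed
  ultimately show ?thesis by linarith
qed

theorem lemma7:
  fixes A :: "'f::field hahn ^ 2 ^ 5"
    and B :: "real ^ 'n ^ 5"
  assumes "infinite (UNIV :: 'f set) \<or> card (UNIV :: 'f set) \<ge> 4"
    and "rank A = 2"
    and "\<And>p q. p \<noteq> q \<Longrightarrow>
      deg (A $ p $ 1 * A $ q $ 2 - A $ q $ 1 * A $ p $ 2)
        = min (deg (A $ p $ 1) + deg (A $ q $ 2)) (deg (A $ q $ 1) + deg (A $ p $ 2))"
    and "\<And>j. card (Theta (deg_vec (column 1 A)) (ereal_vec (column j B))) \<ge> 2"
    and "\<And>j. card (Theta (deg_vec (column 2 A)) (ereal_vec (column j B))) \<ge> 2"
    and "\<And>j. card (Theta (deg_vec (column 1 A)) (ereal_vec (column j B))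
      \<union> Theta (deg_vec (column 2 A)) (ereal_vec (column j B))) \<ge> 3"
  shows "kapranov_rank TYPE('f) B \<le> 3"
  using kapranov_rank_le[OF assms] by simp

end
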